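(* Let $\mathcal X$ be a full subcategory of a category $\mathcal Y$ with inclusion functor $J:\mathcal X\hookrightarrow\mathcal Y$, let $\mathcal P$ be an $\mathcal X$-covering class in $\mathcal Y$, and let $T:\mathcal A^{\rm op}\to\mathcal X$, $S:\mathcal X\to\mathcal A^{\rm op}$ be a dual equivalence with natural isomorphisms $\eta:{\rm Id}_{\mathcal X}\to TS$ and $\varepsilon:{\rm Id}_{\mathcal A}\to ST$ (satisfying the triangular identities). Let $\mathcal B=\mathsf C(\mathcal A,\mathcal P,\mathcal X)/\!\sim$ and let $I:\mathcal A\to\mathcal B$ be the full embedding defined in the context. Then there is a dual equivalence $\tilde T:\mathcal B^{\rm op}\to\mathcal Y$, $\tilde S:\mathcal Y\to\mathcal B^{\rm op}$, with natural isomorphisms $\tilde\eta:{\rm Id}_{\mathcal Y}\to\tilde T\tilde S$, $\tilde\varepsilon:{\rm Id}_{\mathcal B}\to\tilde S\tilde T$ (satisfying the triangular identities), which is a right lifting of the given dual equivalence along $I$ and $J$, i.e. $\tilde T I=JT$. This lifted dual equivalence may be chosen to satisfy $$\tilde T\tilde S={\rm Id}_{\mathcal Y},\quad \tilde\eta=1_{{\rm Id}_{\mathcal Y}},\quad \tilde T\tilde\varepsilon=1_{\tilde T},\quad \tilde\varepsilon\tilde S=1_{\tilde S},$$ and the canonical isomorphism $\gamma:IS\to\tilde SJ$ then satisfies $\tilde T\gamma=J\eta$ and $\gamma T\circ I\varepsilon=\tilde\varepsilon I$.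
   Context: Dual adjunctions. A dual adjunction between $\mathcal A$ and $\mathcal X$ consists of functors $T:\mathcal A^{\rm op}\to\mathcal X$ and $S:\mathcal X\to\mathcal A^{\rm op}$ with $T$ right adjoint to $S$, given by natural transformations $\eta_X:X\to TSX$ in $\mathcal X$ and $\varepsilon_A:A\to STA$ in $\mathcal A$ with $T\varepsilon\circ\eta T=1_T$ and $S\eta\circ\varepsilon S=1_S$ ($T,S$ are treated as contravariant functors, op-notation being suppressed on transformations). It is a dual equivalence if $\eta,\varepsilon$ are isomorphisms. Canonical transformation. For a right lifting $\tilde TI=JT$, the canonical transformation is $\gamma=\tilde SJ\eta\circ\tilde\varepsilon IS:IS\to\tilde SJ$ (an isomorphism for dual equivalences). Covering class. A class $\mathcal P$ of morphisms in $\mathcal Y$ is an $\mathcal X$-covering class if: (P1) $1_X\in\mathcal P$ for all $X\in|\mathcal X|$; (P2) for every $p:Y\to Y'$ in $\mathcal P$ and every $f:X\to Y'$ in $\mathcal Y$ with $X\in|\mathcal X|$ there is $g:X\to Y$ with $p\circ g=f$; (P3) for every $Y\in|\mathcal Y|$ there is $p:X\to Y$ in $\mathcal P$ with $X\in|\mathcal X|$. It is assumed that the domain of every morphism in $\mathcal P$ lies in $\mathcal X$, and that $\mathcal P$ is closed under precomposition with isomorphisms of $\mathcal X$. The category $\mathsf C(\mathcal A,\mathcal P,\mathcal X)$. Objects are pairs $(A,p)$ with $A\in|\mathcal A|$ and $p:TA\to Y$ in $\mathcal P$. Morphisms $(\varphi,f):(A,p:TA\to Y)\to(A',p':TA'\to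 Y')$ are pairs of a morphism $\varphi:A\to A'$ in $\mathcal A$ and $f:Y'\to Y$ in $\mathcal Y$ with $p\circ T\varphi=f\circ p'$; composition is $(\varphi',f')\circ(\varphi,f)=(\varphi'\circ\varphi,f\circ f')$, identities are $(1_A,1_Y)$. On hom-sets, $(\varphi,f)\sim(\psi,g)$ iff $f=g$; this is a compatible equivalence relation, $[\varphi,f]$ denotes the class of $(\varphi,f)$, and $\mathcal B=\mathsf C(\mathcal A,\mathcal P,\mathcal X)/\!\sim$ is the quotient category. The full embedding $I:\mathcal A\to\mathcal B$ is $A\mapsto(A,1_{TA})$, $\varphi\mapsto[\varphi,T\varphi]$. *)

theory Defs
  imports Main
begin

section \<open>Categories\<close>

text \<open>
  A category is given by a set of objects and a set of arrows inside arbitrary types.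
  The operations are only meaningful on these carriers; accordingly, functors and
  transformations are compared only on carriers (see below).
\<close>

record ('o, 'm) cat =
  Obj :: "'o set"
  Arr :: "'m set"
  Dom :: "'m \<Rightarrow> 'o"
  Cod :: "'m \<Rightarrow> 'o"
  Ide :: "'o \<Rightarrow> 'm"
  Comp :: "'m \<Rightarrow> 'm \<Rightarrow> 'm"  (infixl "\<cdot>\<index>" 70)

definition hom :: "('o, 'm) cat \<Rightarrow> 'o \<Rightarrow> 'o \<Rightarrow> 'm set" where
  "hom C x y = {f \<in> Arr C. Dom C f = x \<and> Cod C f = y}"

locale category =
  fixes C :: "('o, 'm) cat" (structure)
  assumes Dom_in: "f \<in> Arr C \<Longrightarrow> Dom C f \<in> Obj C"
    and Cod_in: "f \<in> Arr C \<Longrightarrow> Cod C f \<in> Obj C"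
    and Ide_in: "x \<in> Obj C \<Longrightarrow> Ide C x \<in> hom C x x"
    and Comp_in: "f \<in> hom C x y \<Longrightarrow> g \<in> hom C y z \<Longrightarrow> g \<cdot> f \<in> hom C x z"
    and Comp_Ide: "f \<in> hom C x y \<Longrightarrow> f \<cdot> Ide C x = f"
    and Ide_Comp: "f \<in> hom C x y \<Longrightarrow> Ide C y \<cdot> f = f"
    and Comp_assoc:
      "f \<in> hom C w x \<Longrightarrow> g \<in> hom C x y \<Longrightarrow> h \<in> hom C y z \<Longrightarrow> (h \<cdot> g) \<cdot> f = h \<cdot> (g \<cdot> f)"

definition is_iso :: "('o, 'm) cat \<Rightarrow> 'm \<Rightarrow> bool" where
  "is_iso C f \<longleftrightarrow> f \<in> Arr C \<and>
    (\<exists>g \<in> hom C (Cod C f) (Dom C f).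
      g \<cdot>\<^bsub>C\<^esub> f = Ide C (Dom C f) \<and> f \<cdot>\<^bsub>C\<^esub> g = Ide C (Cod C f))"

definition op :: "('o, 'm) cat \<Rightarrow> ('o, 'm) cat" where
  "op C = \<lparr>Obj = Obj C, Arr = Arr C, Dom = Cod C, Cod = Dom C, Ide = Ide C,
           Comp = (\<lambda>g f. f \<cdot>\<^bsub>C\<^esub> g)\<rparr>"

locale full_subcategory = category Y
  for X Y :: "('o, 'm) cat" +
  assumes Obj_sub: "Obj X \<subseteq> Obj Y"
    and Arr_full: "Arr X = {f \<in> Arr Y. Dom Y f \<in> Obj X \<and> Cod Y f \<in> Obj X}"
    and Dom_eq: "f \<in> Arr X \<Longrightarrow> Dom X f = Dom Y f"
    and Cod_eq: "f \<in> Arr X \<Longrightarrow> Cod X f = Cod Y f"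
    and Ide_eq: "x \<in> Obj X \<Longrightarrow> Ide X x = Ide Y x"
    and Comp_eq: "f \<in> Arr X \<Longrightarrow> g \<in> Arr X \<Longrightarrow> Dom Y g = Cod Y f \<Longrightarrow> g \<cdot>\<^bsub>X\<^esub> f = g \<cdot>\<^bsub>Y\<^esub> f"


section \<open>Functors and natural transformations\<close>

record ('o1, 'm1, 'o2, 'm2) func =
  FObj :: "'o1 \<Rightarrow> 'o2"
  FArr :: "'m1 \<Rightarrow> 'm2"

locale is_functor = C: category C + D: category D
  for C :: "('o1, 'm1) cat" and D :: "('o2, 'm2) cat"
    and F :: "('o1, 'm1, 'o2, 'm2) func" +
  assumes FObj_in: "x \<in> Obj C \<Longrightarrow> FObj F x \<in> Obj D"
    and FArr_in: "f \<in> hom C x y \<Longrightarrow> FArr F f \<in> hom D (FObj F x) (FObj F y)"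
    and FArr_Ide: "x \<in> Obj C \<Longrightarrow> FArr F (Ide C x) = Ide D (FObj F x)"
    and FArr_Comp: "f \<in> hom C x y \<Longrightarrow> g \<in> hom C y z \<Longrightarrow>
      FArr F (g \<cdot>\<^bsub>C\<^esub> f) = FArr F g \<cdot>\<^bsub>D\<^esub> FArr F f"

text \<open>
  A functor and its opposite have the same underlying data, so that the data of a functor
  can be composed regardless of variance.  The inclusion functor of a subcategory also has
  \<open>id_func\<close> as its data.
\<close>

definition id_func :: "('o, 'm, 'o, 'm) func" where
  "id_func = \<lparr>FObj = (\<lambda>x. x), FArr = (\<lambda>f. f)\<rparr>"

definition comp_func ::
  "('o2, 'm2, 'o3, 'm3) func \<Rightarrow> ('o1, 'm1, 'o2, 'm2) func \<Rightarrow> ('o1, 'm1, 'o3, 'm3) func"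
  (infixl "\<circ>\<^sub>F" 75) where
  "G \<circ>\<^sub>F F = \<lparr>FObj = (\<lambda>x. FObj G (FObj F x)), FArr = (\<lambda>f. FArr G (FArr F f))\<rparr>"

definition func_eq ::
  "('o1, 'm1) cat \<Rightarrow> ('o1, 'm1, 'o2, 'm2) func \<Rightarrow> ('o1, 'm1, 'o2, 'm2) func \<Rightarrow> bool" where
  "func_eq C F G \<longleftrightarrow>
    (\<forall>x \<in> Obj C. FObj F x = FObj G x) \<and> (\<forall>f \<in> Arr C. FArr F f = FArr G f)"

locale nat_trans = F: is_functor C D F + G: is_functor C D G
  for C :: "('o1, 'm1) cat" and D :: "('o2, 'm2) cat"
    and F G :: "('o1, 'm1, 'o2, 'm2) func" and \<tau> :: "'o1 \<Rightarrow> 'm2" +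
  assumes component_in: "x \<in> Obj C \<Longrightarrow> \<tau> x \<in> hom D (FObj F x) (FObj G x)"
    and naturality: "f \<in> hom C x y \<Longrightarrow> \<tau> y \<cdot>\<^bsub>D\<^esub> FArr F f = FArr G f \<cdot>\<^bsub>D\<^esub> \<tau> x"

locale nat_iso = nat_trans +
  assumes component_iso: "x \<in> Obj C \<Longrightarrow> is_iso D (\<tau> x)"

definition id_trans :: "('o2, 'm2) cat \<Rightarrow> ('o1, 'm1, 'o2, 'm2) func \<Rightarrow> 'o1 \<Rightarrow> 'm2" where
  "id_trans D F = (\<lambda>x. Ide D (FObj F x))"

definition vcomp :: "('o2, 'm2) cat \<Rightarrow> ('o1 \<Rightarrow> 'm2) \<Rightarrow> ('o1 \<Rightarrow> 'm2) \<Rightarrow> 'o1 \<Rightarrow> 'm2" where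
  "vcomp D \<sigma> \<tau> = (\<lambda>x. \<sigma> x \<cdot>\<^bsub>D\<^esub> \<tau> x)"

text \<open>The whiskerings \<open>F\<tau>\<close> and \<open>\<tau>F\<close>.\<close>

definition whisker_l :: "('o2, 'm2, 'o3, 'm3) func \<Rightarrow> ('o1 \<Rightarrow> 'm2) \<Rightarrow> 'o1 \<Rightarrow> 'm3"
  (infixr "\<rhd>" 80) where
  "F \<rhd> \<tau> = (\<lambda>x. FArr F (\<tau> x))"

definition whisker_r :: "('o2 \<Rightarrow> 'm3) \<Rightarrow> ('o1, 'm1, 'o2, 'm2) func \<Rightarrow> 'o1 \<Rightarrow> 'm3"
  (infixl "\<lhd>" 80) where
  "\<tau> \<lhd> F = (\<lambda>x. \<tau> (FObj F x))"

definition trans_eq :: "('o1, 'm1) cat \<Rightarrow> ('o1 \<Rightarrow> 'm2) \<Rightarrow> ('o1 \<Rightarrow> 'm2) \<Rightarrow> bool" where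
  "trans_eq C \<sigma> \<tau> \<longleftrightarrow> (\<forall>x \<in> Obj C. \<sigma> x = \<tau> x)"


section \<open>Dual adjunctions\<close>

text \<open>
  The unit lives in \<open>X\<close> and the counit in \<open>A\<close> (not in \<open>op A\<close>), so both triangular
  identities are composites in these categories.
\<close>

locale dual_adjunction =
  T: is_functor "op A" X T + S: is_functor X "op A" S +
  \<eta>: nat_trans X X id_func "T \<circ>\<^sub>F S" \<eta> + \<epsilon>: nat_trans A A id_func "S \<circ>\<^sub>F T" \<epsilon>
  for A :: "('a, 'f) cat" and X :: "('x, 'm) cat"
    and T :: "('a, 'f, 'x, 'm) func" and S :: "('x, 'm, 'a, 'f) func"
    and \<eta> :: "'x \<Rightarrow> 'm" and \<epsilon> :: "'a \<Rightarrow> 'f" +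
  assumes triangle_T: "trans_eq A (vcomp X (T \<rhd> \<epsilon>) (\<eta> \<lhd> T)) (id_trans X T)"
    and triangle_S: "trans_eq X (vcomp A (S \<rhd> \<eta>) (\<epsilon> \<lhd> S)) (id_trans A S)"

locale dual_equivalence = dual_adjunction +
  assumes unit_iso: "nat_iso X X id_func (T \<circ>\<^sub>F S) \<eta>"
    and counit_iso: "nat_iso A A id_func (S \<circ>\<^sub>F T) \<epsilon>"

definition right_lifting ::
  "('a, 'f) cat \<Rightarrow> ('a, 'f, 'x, 'm) func \<Rightarrow> ('b, 'g, 'y, 'n) func \<Rightarrow>
   ('a, 'f, 'b, 'g) func \<Rightarrow> ('x, 'm, 'y, 'n) func \<Rightarrow> bool" where
  "right_lifting A T T' I J \<longleftrightarrow> func_eq (op A) (T' \<circ>\<^sub>F I) (J \<circ>\<^sub>F T)"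

definition canonical_trans ::
  "('b, 'g) cat \<Rightarrow> ('x, 'm, 'a, 'f) func \<Rightarrow> ('y, 'n, 'b, 'g) func \<Rightarrow>
   ('a, 'f, 'b, 'g) func \<Rightarrow> ('x, 'm, 'y, 'n) func \<Rightarrow>
   ('x \<Rightarrow> 'm) \<Rightarrow> ('b \<Rightarrow> 'g) \<Rightarrow> 'x \<Rightarrow> 'g" where
  "canonical_trans B S S' I J \<eta> \<epsilon>' = vcomp B (S' \<rhd> J \<rhd> \<eta>) (\<epsilon>' \<lhd> (I \<circ>\<^sub>F S))"


section \<open>Covering classes\<close>

locale covering_class = full_subcategory X Y
  for X Y :: "('o, 'm) cat" and P :: "'m set" +
  assumes P_Arr: "P \<subseteq> Arr Y"
    and P1: "x \<in> Obj X \<Longrightarrow> Ide Y x \<in> P"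
    and P2: "p \<in> P \<Longrightarrow> x \<in> Obj X \<Longrightarrow> f \<in> hom Y x (Cod Y p) \<Longrightarrow>
      \<exists>g \<in> hom Y x (Dom Y p). p \<cdot>\<^bsub>Y\<^esub> g = f"
    and P3: "y \<in> Obj Y \<Longrightarrow> \<exists>p \<in> P. Dom Y p \<in> Obj X \<and> Cod Y p = y"
    and P_Dom: "p \<in> P \<Longrightarrow> Dom Y p \<in> Obj X"
    and P_iso: "p \<in> P \<Longrightarrow> is_iso X i \<Longrightarrow> Cod X i = Dom Y p \<Longrightarrow> p \<cdot>\<^bsub>Y\<^esub> i \<in> P"


section \<open>The category of covers and its quotient\<close>

text \<open>
  An arrow \<open>(\<phi>, f)\<close> is stored together with its source and its target, since neither
  \<open>p\<close> nor \<open>p'\<close> can be recovered from \<open>\<phi>\<close> and \<open>f\<close>.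
\<close>

type_synonym ('a, 'f, 'm) cover_arr = "('a \<times> 'm) \<times> ('f \<times> 'm) \<times> ('a \<times> 'm)"

definition cover_cat ::
  "('a, 'f) cat \<Rightarrow> ('y, 'm) cat \<Rightarrow> 'm set \<Rightarrow> ('a, 'f, 'y, 'm) func \<Rightarrow>
   ('a \<times> 'm, ('a, 'f, 'm) cover_arr) cat" where
  "cover_cat A Y P T =
    (let Ob = {(a, p). a \<in> Obj A \<and> p \<in> P \<and> Dom Y p = FObj T a} in
     \<lparr>Obj = Ob,
      Arr = {((a, p), (\<phi>, f), (a', p')) | a p \<phi> f a' p'.
               (a, p) \<in> Ob \<and> (a', p') \<in> Ob \<and>
               \<phi> \<in> hom A a a' \<and> f \<in> hom Y (Cod Y p') (Cod Y p) \<and>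
               p \<cdot>\<^bsub>Y\<^esub> FArr T \<phi> = f \<cdot>\<^bsub>Y\<^esub> p'},
      Dom = (\<lambda>(s, _, t). s),
      Cod = (\<lambda>(s, _, t). t),
      Ide = (\<lambda>(a, p). ((a, p), (Ide A a, Ide Y (Cod Y p)), (a, p))),
      Comp = (\<lambda>(_, (\<phi>', f'), t) (s, (\<phi>, f), _). (s, (\<phi>' \<cdot>\<^bsub>A\<^esub> \<phi>, f \<cdot>\<^bsub>Y\<^esub> f'), t))\<rparr>)"

definition cover_rel ::
  "('a, 'f) cat \<Rightarrow> ('y, 'm) cat \<Rightarrow> 'm set \<Rightarrow> ('a, 'f, 'y, 'm) func \<Rightarrow>
   ('a, 'f, 'm) cover_arr rel" where
  "cover_rel A Y P T =
    {((s, (\<phi>, f), t), (s, (\<psi>, g), t)) | s t \<phi> f \<psi> g.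
       (s, (\<phi>, f), t) \<in> Arr (cover_cat A Y P T) \<and>
       (s, (\<psi>, g), t) \<in> Arr (cover_cat A Y P T) \<and> f = g}"

text \<open>
  The quotient of \<open>C\<close> by a compatible equivalence relation \<open>R\<close> on arrows relating only
  parallel arrows: all members of a class share their domain and codomain, and the union
  in the composition is a union of copies of a single class.
\<close>

definition quotient_cat :: "('o, 'm) cat \<Rightarrow> 'm rel \<Rightarrow> ('o, 'm set) cat" where
  "quotient_cat C R =
    \<lparr>Obj = Obj C,
     Arr = Arr C // R,
     Dom = (\<lambda>K. the_elem (Dom C ` K)),
     Cod = (\<lambda>K. the_elem (Cod C ` K)),
     Ide = (\<lambda>x. R `` {Ide C x}),
     Comp = (\<lambda>L K. \<Union>g \<in> L. \<Union>f \<in> K. R `` {g \<cdot>\<^bsub>C\<^esub> f})\<rparr>"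

definition cover_quotient ::
  "('a, 'f) cat \<Rightarrow> ('y, 'm) cat \<Rightarrow> 'm set \<Rightarrow> ('a, 'f, 'y, 'm) func \<Rightarrow>
   ('a \<times> 'm, ('a, 'f, 'm) cover_arr set) cat" where
  "cover_quotient A Y P T = quotient_cat (cover_cat A Y P T) (cover_rel A Y P T)"

definition cover_embedding ::
  "('a, 'f) cat \<Rightarrow> ('y, 'm) cat \<Rightarrow> 'm set \<Rightarrow> ('a, 'f, 'y, 'm) func \<Rightarrow>
   ('a, 'f, 'a \<times> 'm, ('a, 'f, 'm) cover_arr set) func" where
  "cover_embedding A Y P T =
    (let e = (\<lambda>a. (a, Ide Y (FObj T a))) in
     \<lparr>FObj = e,
      FArr = (\<lambda>\<phi>. cover_rel A Y P T `` {(e (Dom A \<phi>), (\<phi>, FArr T \<phi>), e (Cod A \<phi>))})\<rparr>)"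

definition normalized ::
  "('b, 'g) cat \<Rightarrow> ('y, 'n) cat \<Rightarrow> ('b, 'g, 'y, 'n) func \<Rightarrow> ('y, 'n, 'b, 'g) func \<Rightarrow>
   ('y \<Rightarrow> 'n) \<Rightarrow> ('b \<Rightarrow> 'g) \<Rightarrow> bool" where
  "normalized B Y T S \<eta> \<epsilon> \<longleftrightarrow>
    func_eq Y (T \<circ>\<^sub>F S) id_func \<and>
    trans_eq Y \<eta> (id_trans Y id_func) \<and>
    trans_eq B (T \<rhd> \<epsilon>) (id_trans Y T) \<and>
    trans_eq Y (\<epsilon> \<lhd> S) (id_trans B S)"

end

theory Submission
  imports Defs
begin

text \<open>
  An arrow \<open>[\<phi>, f]\<close> of the quotient \<open>B\<close> is determined, between given objects, by its second
  component.  So \<open>(A, p : TA \<rightarrow> Y) \<mapsto> Y\<close>, \<open>[\<phi>, f] \<mapsto> f\<close> is a contravariant functor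
  \<open>B \<rightarrow> Y\<close> that is faithful by the very choice of the equivalence relation.  It is full: for
  \<open>f : Y' \<rightarrow> Y\<close> the composite \<open>f \<circ> p' : TA' \<rightarrow> Y\<close> starts in \<open>X\<close> and hence factors through the cover
  \<open>p\<close> by some \<open>g : TA' \<rightarrow> TA\<close>, and \<open>g\<close> is \<open>T\<phi>\<close> for some \<open>\<phi>\<close> because \<open>T\<close> is full
  (\<open>base_full\<close>).  Every object \<open>y\<close> of \<open>Y\<close> is attained on the nose: a cover \<open>p : x \<rightarrow> y\<close> can be
  precomposed with an isomorphism \<open>TSx \<rightarrow> x\<close> (\<open>base_surj\<close>).

  A contravariant functor that is full, faithful and strictly surjective on objects is half of a
  dual equivalence: choose a preimage \<open>s y\<close> of each object \<open>y\<close> and lift arrows uniquely.  Since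
  the preimages are strict, the unit is an identity, and the counit is the lift of identities,
  which gives the normalization (\<open>normalized_dual_equivalence_of_section\<close>).

  For any normalized lifting, \<open>T'\<gamma> = J\<eta>\<close> is immediate from \<open>T'\<epsilon>' = 1\<close> and \<open>T'S' = Id\<close>.  Both
  the naturality of \<open>\<gamma>\<close> and the equation \<open>\<gamma>T \<circ> I\<epsilon> = \<epsilon>'I\<close> are equations between parallel arrows
  of \<open>B\<close>; the faithful functor \<open>T'\<close> carries the former to the naturality of \<open>\<eta>\<close> and the latter
  to a triangular identity (\<open>canonical_trans_of_normalized_lifting\<close>).
\<close>

section \<open>Elementary facts on categories and functors\<close>

lemma op_simps [simp]:
  "Obj (op C) = Obj C" "Arr (op C) = Arr C" "Dom (op C) = Cod C" "Cod (op C) = Dom C"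
  "Ide (op C) = Ide C" "g \<cdot>\<^bsub>op C\<^esub> f = f \<cdot>\<^bsub>C\<^esub> g" "hom (op C) x y = hom C y x"
  by (auto simp: op_def hom_def)

lemma func_simps [simp]:
  "FObj id_func x = x" "FArr id_func f = f"
  "FObj (G \<circ>\<^sub>F F) x = FObj G (FObj F x)" "FArr (G \<circ>\<^sub>F F) f = FArr G (FArr F f)"
  by (auto simp: id_func_def comp_func_def)

lemma homD: "f \<in> hom C x y \<Longrightarrow> f \<in> Arr C" "f \<in> hom C x y \<Longrightarrow> Dom C f = x" "f \<in> hom C x y \<Longrightarrow> Cod C f = y"
  by (auto simp: hom_def)

lemma Arr_hom: "f \<in> Arr C \<Longrightarrow> f \<in> hom C (Dom C f) (Cod C f)"
  by (auto simp: hom_def)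

lemma (in category) hom_Obj: "f \<in> hom C x y \<Longrightarrow> x \<in> Obj C \<and> y \<in> Obj C"
  using Dom_in Cod_in by (auto simp: hom_def)

lemma (in category) category_op: "category (op C)"
  by unfold_locales (use Dom_in Cod_in Ide_in Comp_in Comp_Ide Ide_Comp Comp_assoc in auto)

lemma is_iso_iff_inverse:
  assumes "f \<in> hom C x y"
  shows "is_iso C f \<longleftrightarrow> (\<exists>g \<in> hom C y x. g \<cdot>\<^bsub>C\<^esub> f = Ide C x \<and> f \<cdot>\<^bsub>C\<^esub> g = Ide C y)"
  using assms by (auto simp: is_iso_def hom_def)

lemma is_iso_op: "is_iso (op C) f \<longleftrightarrow> is_iso C f"
  by (auto simp: is_iso_def)

lemma (in category) is_iso_Comp:
  assumes f: "f \<in> hom C x y" "is_iso C f" and g: "g \<in> hom C y z" "is_iso C g"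
  shows "is_iso C (g \<cdot> f)"
proof -
  obtain f' where f': "f' \<in> hom C y x" "f' \<cdot> f = Ide C x" "f \<cdot> f' = Ide C y"
    using f is_iso_iff_inverse[OF f(1)] by blast
  obtain g' where g': "g' \<in> hom C z y" "g' \<cdot> g = Ide C y" "g \<cdot> g' = Ide C z"
    using g is_iso_iff_inverse[OF g(1)] by blast
  have "(f' \<cdot> g') \<cdot> (g \<cdot> f) = f' \<cdot> ((g' \<cdot> g) \<cdot> f)"
    using Comp_assoc[OF Comp_in[OF f(1) g(1)] g'(1) f'(1)] Comp_assoc[OF f(1) g(1) g'(1)] by simp
  moreover have "(g \<cdot> f) \<cdot> (f' \<cdot> g') = g \<cdot> ((f \<cdot> f') \<cdot> g')"
    using Comp_assoc[OF Comp_in[OF g'(1) f'(1)] f(1) g(1)] Comp_assoc[OF g'(1) f'(1) f(1)] by simp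
  ultimately have "(f' \<cdot> g') \<cdot> (g \<cdot> f) = Ide C x" "(g \<cdot> f) \<cdot> (f' \<cdot> g') = Ide C z"
    using f' g' Ide_Comp[OF f(1)] Ide_Comp[OF g'(1)] by simp_all
  then show ?thesis
    using is_iso_iff_inverse[OF Comp_in[OF f(1) g(1)]] Comp_in[OF g'(1) f'(1)] by blast
qed

lemma (in category) is_iso_Ide: "x \<in> Obj C \<Longrightarrow> is_iso C (Ide C x)"
  using is_iso_iff_inverse[OF Ide_in] Ide_in Ide_Comp by metis

lemma (in category) iso_cancel_left:
  assumes e: "e \<in> hom C y z" "is_iso C e" and fg: "f \<in> hom C x y" "g \<in> hom C x y"
    and eq: "e \<cdot> f = e \<cdot> g"
  shows "f = g"
proof -
  obtain e' where e': "e' \<in> hom C z y" "e' \<cdot> e = Ide C y"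
    using e is_iso_iff_inverse[OF e(1)] by blast
  have "f = (e' \<cdot> e) \<cdot> f" using e' fg Ide_Comp by simp
  also have "\<dots> = (e' \<cdot> e) \<cdot> g"
    using eq Comp_assoc[OF fg(1) e(1) e'(1)] Comp_assoc[OF fg(2) e(1) e'(1)] by simp
  also have "\<dots> = g" using e' fg Ide_Comp by simp
  finally show ?thesis .
qed

lemma (in is_functor) FArr_iso:
  assumes f: "f \<in> hom C x y" "is_iso C f"
  shows "is_iso D (FArr F f)"
proof -
  obtain f' where f': "f' \<in> hom C y x" "f' \<cdot>\<^bsub>C\<^esub> f = Ide C x" "f \<cdot>\<^bsub>C\<^esub> f' = Ide C y"
    using f is_iso_iff_inverse[OF f(1)] by blast
  have "FArr F f' \<cdot>\<^bsub>D\<^esub> FArr F f = Ide D (FObj F x)" "FArr F f \<cdot>\<^bsub>D\<^esub> FArr F f' = Ide D (FObj F y)"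
    using FArr_Comp[OF f(1) f'(1)] FArr_Comp[OF f'(1) f(1)] f' FArr_Ide C.hom_Obj[OF f(1)] by auto
  then show ?thesis
    using is_iso_iff_inverse[OF FArr_in[OF f(1)]] FArr_in[OF f'(1)] by blast
qed

lemma is_functor_comp:
  assumes "is_functor C D F" "is_functor D E G"
  shows "is_functor C E (G \<circ>\<^sub>F F)"
proof -
  interpret F: is_functor C D F by fact
  interpret G: is_functor D E G by fact
  show ?thesis
    by unfold_locales
      (auto simp: F.FObj_in G.FObj_in F.FArr_Ide G.FArr_Ide intro: F.FArr_in G.FArr_in,
       metis F.FArr_Comp F.FArr_in G.FArr_Comp)
qed

lemma is_functor_op:
  assumes "is_functor C D F"
  shows "is_functor (op C) (op D) F"
proof -
  interpret F: is_functor C D F by fact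
  interpret C': category "op C" by (rule F.C.category_op)
  interpret D': category "op D" by (rule F.D.category_op)
  show ?thesis
    by unfold_locales (auto intro: F.FObj_in F.FArr_in F.FArr_Ide F.FArr_Comp)
qed

lemma op_op [simp]: "op (op C) = (C :: ('o, 'm) cat)"
  by (simp add: op_def)

lemma (in category) is_functor_id: "is_functor C C id_func"
  by unfold_locales auto

lemma (in full_subcategory) hom_sub: "x \<in> Obj X \<Longrightarrow> y \<in> Obj X \<Longrightarrow> hom X x y = hom Y x y"
  using Arr_full Dom_eq Cod_eq by (auto simp: hom_def)

lemma (in full_subcategory) hom_subD: "f \<in> hom X x y \<Longrightarrow> f \<in> hom Y x y \<and> x \<in> Obj X \<and> y \<in> Obj X"
  using Arr_full Dom_eq Cod_eq by (auto simp: hom_def)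

lemma (in full_subcategory) Comp_sub:
  "f \<in> hom X x y \<Longrightarrow> g \<in> hom X y z \<Longrightarrow> g \<cdot>\<^bsub>X\<^esub> f = g \<cdot>\<^bsub>Y\<^esub> f"
  using Comp_eq Dom_eq Cod_eq by (auto simp: hom_def)

lemma (in full_subcategory) category_sub: "category X"
proof
  fix f assume "f \<in> Arr X"
  then show "Dom X f \<in> Obj X" "Cod X f \<in> Obj X"
    using Arr_full Dom_eq Cod_eq by auto
next
  fix x assume x: "x \<in> Obj X"
  then show "Ide X x \<in> hom X x x" using Ide_eq Ide_in hom_sub Obj_sub by auto
next
  fix f g x y z assume fg: "f \<in> hom X x y" "g \<in> hom X y z"
  then show "g \<cdot>\<^bsub>X\<^esub> f \<in> hom X x z"
    by (metis Comp_in Comp_sub hom_sub hom_subD)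
next
  fix f x y assume f: "f \<in> hom X x y"
  note f' = hom_subD[OF f]
  have "Ide X x \<in> hom X x x" "Ide X y \<in> hom X y y"
    using f' Ide_eq Ide_in hom_sub Obj_sub by auto
  then show "f \<cdot>\<^bsub>X\<^esub> Ide X x = f" "Ide X y \<cdot>\<^bsub>X\<^esub> f = f"
    using f f' Comp_sub Ide_eq Comp_Ide Ide_Comp by auto
next
  fix f g h w x y z assume fgh: "f \<in> hom X w x" "g \<in> hom X x y" "h \<in> hom X y z"
  have "g \<cdot>\<^bsub>X\<^esub> f \<in> hom X w y" "h \<cdot>\<^bsub>X\<^esub> g \<in> hom X x z"
    using fgh by (metis Comp_in Comp_sub hom_sub hom_subD)+
  then show "(h \<cdot>\<^bsub>X\<^esub> g) \<cdot>\<^bsub>X\<^esub> f = h \<cdot>\<^bsub>X\<^esub> (g \<cdot>\<^bsub>X\<^esub> f)"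
    using fgh Comp_sub Comp_assoc hom_subD by (metis (no_types, lifting))
qed

lemma (in full_subcategory) is_functor_inclusion: "is_functor X Y id_func"
proof -
  interpret X: category X by (rule category_sub)
  show ?thesis
    by unfold_locales (use Obj_sub hom_subD Ide_eq Comp_sub in auto)
qed

section \<open>Full, faithful contravariant functors and dual equivalences\<close>

context dual_equivalence
begin

lemma unit_in: "x \<in> Obj X \<Longrightarrow> \<eta> x \<in> hom X x (FObj T (FObj S x))"
  using \<eta>.component_in by simp

lemma counit_in: "a \<in> Obj A \<Longrightarrow> \<epsilon> a \<in> hom A a (FObj S (FObj T a))"
  using \<epsilon>.component_in by simp

lemma is_iso_unit: "x \<in> Obj X \<Longrightarrow> is_iso X (\<eta> x)"
  using unit_iso by (simp add: nat_iso.component_iso)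

lemma is_iso_counit: "a \<in> Obj A \<Longrightarrow> is_iso A (\<epsilon> a)"
  using counit_iso by (simp add: nat_iso.component_iso)

lemma triangle_T_at: "a \<in> Obj A \<Longrightarrow> FArr T (\<epsilon> a) \<cdot>\<^bsub>X\<^esub> \<eta> (FObj T a) = Ide X (FObj T a)"
  using triangle_T by (simp add: trans_eq_def vcomp_def whisker_l_def whisker_r_def id_trans_def)

text \<open>
  By naturality of the counit \<open>T\<phi>\<close> determines \<open>\<epsilon> b \<circ> \<phi> = ST\<phi> \<circ> \<epsilon> a\<close>, and the invertible
  \<open>\<epsilon> b\<close> cancels.
\<close>

lemma T_faithful:
  assumes fg: "\<phi> \<in> hom A a b" "\<psi> \<in> hom A a b" and eq: "FArr T \<phi> = FArr T \<psi>"
  shows "\<phi> = \<psi>"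
proof -
  have ab: "a \<in> Obj A" "b \<in> Obj A" using \<epsilon>.F.C.hom_Obj[OF fg(1)] by auto
  have "\<epsilon> b \<cdot>\<^bsub>A\<^esub> \<phi> = \<epsilon> b \<cdot>\<^bsub>A\<^esub> \<psi>"
    using \<epsilon>.naturality[OF fg(1)] \<epsilon>.naturality[OF fg(2)] eq by simp
  then show ?thesis
    using \<epsilon>.F.C.iso_cancel_left[OF counit_in is_iso_counit fg] ab by blast
qed

text \<open>
  The preimage of \<open>g\<close> is its transpose across the counit, \<open>\<epsilon>\<^sub>b\<^sup>-\<^sup>1 \<circ> Sg \<circ> \<epsilon>\<^sub>a\<close>; naturality of
  the unit and the triangular identity for \<open>T\<close> show that \<open>T\<close> returns \<open>g\<close>.
\<close>

lemma T_full:
  assumes ab: "a \<in> Obj A" "b \<in> Obj A" and g: "g \<in> hom X (FObj T b) (FObj T a)"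
  obtains \<phi> where "\<phi> \<in> hom A a b" "FArr T \<phi> = g"
proof -
  obtain e where e: "e \<in> hom A (FObj S (FObj T b)) b" "e \<cdot>\<^bsub>A\<^esub> \<epsilon> b = Ide A b"
      "\<epsilon> b \<cdot>\<^bsub>A\<^esub> e = Ide A (FObj S (FObj T b))"
    using is_iso_counit[OF ab(2)] is_iso_iff_inverse[OF counit_in[OF ab(2)]] by blast
  let ?TST = "\<lambda>x. FObj T (FObj S (FObj T x))"
  have Ob: "FObj T a \<in> Obj X" "FObj T b \<in> Obj X" using ab T.FObj_in by auto
  have Sg: "FArr S g \<in> hom A (FObj S (FObj T a)) (FObj S (FObj T b))"
    using S.FArr_in[OF g] by simp
  have Tea: "FArr T (\<epsilon> a) \<in> hom X (?TST a) (FObj T a)"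
    using T.FArr_in[of "\<epsilon> a"] counit_in[OF ab(1)] by simp
  have Teb: "FArr T (\<epsilon> b) \<in> hom X (?TST b) (FObj T b)"
    using T.FArr_in[of "\<epsilon> b"] counit_in[OF ab(2)] by simp
  have Te: "FArr T e \<in> hom X (FObj T b) (?TST b)"
    using T.FArr_in[of e] e by simp
  have TSg: "FArr T (FArr S g) \<in> hom X (?TST b) (?TST a)"
    using T.FArr_in[of "FArr S g"] Sg by simp
  \<comment> \<open>Both are right inverse to the invertible arrow \<open>T (\<epsilon> b)\<close>.\<close>
  have Te_eq: "FArr T e = \<eta> (FObj T b)"
  proof -
    have "FArr T (\<epsilon> b) \<cdot>\<^bsub>X\<^esub> FArr T e = Ide X (FObj T b)"
      using T.FArr_Comp[of e b _ "\<epsilon> b" b] T.FArr_Comp[of "\<epsilon> b" _ _ e] e counit_in[OF ab(2)]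
        T.FArr_Ide ab by (metis op_simps(1,5,6,7))
    moreover have "is_iso X (FArr T (\<epsilon> b))"
      using T.FArr_iso[of "\<epsilon> b"] counit_in[OF ab(2)] is_iso_counit[OF ab(2)]
      by (simp add: is_iso_op)
    ultimately show ?thesis
      using T.D.iso_cancel_left[OF Teb _ Te unit_in[OF Ob(2)]] triangle_T_at[OF ab(2)] by simp
  qed
  let ?\<phi> = "e \<cdot>\<^bsub>A\<^esub> (FArr S g \<cdot>\<^bsub>A\<^esub> \<epsilon> a)"
  have Se: "FArr S g \<cdot>\<^bsub>A\<^esub> \<epsilon> a \<in> hom A a (FObj S (FObj T b))"
    using \<epsilon>.F.C.Comp_in[OF counit_in[OF ab(1)] Sg] .
  have "FArr T ?\<phi> = FArr T (FArr S g \<cdot>\<^bsub>A\<^esub> \<epsilon> a) \<cdot>\<^bsub>X\<^esub> FArr T e"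
    using T.FArr_Comp[of e b _ "FArr S g \<cdot>\<^bsub>A\<^esub> \<epsilon> a" a] e(1) Se by simp
  also have "FArr T (FArr S g \<cdot>\<^bsub>A\<^esub> \<epsilon> a) = FArr T (\<epsilon> a) \<cdot>\<^bsub>X\<^esub> FArr T (FArr S g)"
    using T.FArr_Comp[of "FArr S g" _ _ "\<epsilon> a" a] Sg counit_in[OF ab(1)] by simp
  also have "\<dots> \<cdot>\<^bsub>X\<^esub> FArr T e = FArr T (\<epsilon> a) \<cdot>\<^bsub>X\<^esub> (FArr T (FArr S g) \<cdot>\<^bsub>X\<^esub> \<eta> (FObj T b))"
    using T.D.Comp_assoc[OF Te TSg Tea] Te_eq by simp
  also have "FArr T (FArr S g) \<cdot>\<^bsub>X\<^esub> \<eta> (FObj T b) = \<eta> (FObj T a) \<cdot>\<^bsub>X\<^esub> g"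
    using \<eta>.naturality[OF g] by simp
  also have "FArr T (\<epsilon> a) \<cdot>\<^bsub>X\<^esub> (\<eta> (FObj T a) \<cdot>\<^bsub>X\<^esub> g) = Ide X (FObj T a) \<cdot>\<^bsub>X\<^esub> g"
    using T.D.Comp_assoc[OF g unit_in[OF Ob(1)] Tea] triangle_T_at[OF ab(1)] by simp
  also have "\<dots> = g" using T.D.Ide_Comp[OF g] .
  finally show thesis
    using that \<epsilon>.F.C.Comp_in[OF Se e(1)] by blast
qed

end

text \<open>
  The strictness \<open>T (s y) = y\<close> is what makes the unit an identity.  Every equation required in
  \<open>B\<close> (functoriality of \<open>S\<close>, naturality and invertibility of the counit, \<open>\<epsilon>S = 1\<close>) relates
  parallel arrows and is verified after applying the faithful functor \<open>T\<close>, where both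
  sides evaluate to the same arrow of \<open>Y\<close>.
\<close>

lemma normalized_dual_equivalence_of_section:
  assumes B: "category B" and T: "is_functor (op B) Y T"
    and faithful: "\<And>b b' k l. k \<in> hom B b b' \<Longrightarrow> l \<in> hom B b b' \<Longrightarrow> FArr T k = FArr T l \<Longrightarrow> k = l"
    and full: "\<And>b b' f. b \<in> Obj B \<Longrightarrow> b' \<in> Obj B \<Longrightarrow> f \<in> hom Y (FObj T b') (FObj T b) \<Longrightarrow>
      \<exists>k \<in> hom B b b'. FArr T k = f"
    and s: "\<And>y. y \<in> Obj Y \<Longrightarrow> s y \<in> Obj B \<and> FObj T (s y) = y"
  shows "\<exists>S \<eta> \<epsilon>. dual_equivalence B Y T S \<eta> \<epsilon> \<and> normalized B Y T S \<eta> \<epsilon>"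
proof -
  interpret B: category B by fact
  interpret T: is_functor "op B" Y T by fact
  define lift where "lift b b' f = (THE k. k \<in> hom B b b' \<and> FArr T k = f)" for b b' f
  have lift: "lift b b' f \<in> hom B b b' \<and> FArr T (lift b b' f) = f"
    if "b \<in> Obj B" "b' \<in> Obj B" "f \<in> hom Y (FObj T b') (FObj T b)" for b b' f
  proof -
    have "\<exists>!k. k \<in> hom B b b' \<and> FArr T k = f"
      using full[OF that] faithful by blast
    then show ?thesis unfolding lift_def by (rule theI')
  qed
  have T_Comp: "FArr T (l \<cdot>\<^bsub>B\<^esub> k) = FArr T k \<cdot>\<^bsub>Y\<^esub> FArr T l"
    if "k \<in> hom B b c" "l \<in> hom B c d" for k l b c d
    using T.FArr_Comp[of l d c k b] that by simp
  have T_in: "FArr T k \<in> hom Y (FObj T c) (FObj T b)" if "k \<in> hom B b c" for k b c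
    using T.FArr_in[of k c b] that by simp
  have T_Obj: "FObj T b \<in> Obj Y" if "b \<in> Obj B" for b using T.FObj_in that by simp
  have T_Ide: "FArr T (Ide B b) = Ide Y (FObj T b)" if "b \<in> Obj B" for b
    using T.FArr_Ide that by simp
  define S where "S = \<lparr>FObj = s, FArr = (\<lambda>f. lift (s (Cod Y f)) (s (Dom Y f)) f)\<rparr>"
  define \<epsilon> where "\<epsilon> b = lift b (s (FObj T b)) (Ide Y (FObj T b))" for b
  have S_Obj: "FObj S y = s y" for y by (simp add: S_def)
  have S_Arr: "FArr S f \<in> hom B (s z) (s y)" "FArr T (FArr S f) = f" if f: "f \<in> hom Y y z" for f y z
    using lift[of "s z" "s y" f] s T.D.hom_Obj[OF f] f by (auto simp: S_def homD)
  have eps: "\<epsilon> b \<in> hom B b (s (FObj T b))" "FArr T (\<epsilon> b) = Ide Y (FObj T b)" if "b \<in> Obj B" for b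
    using lift[of b "s (FObj T b)" "Ide Y (FObj T b)"] s T.D.Ide_in T_Obj that
    by (auto simp: \<epsilon>_def)
  have S_functor: "is_functor Y (op B) S"
  proof (intro is_functor.intro is_functor_axioms.intro)
    fix x assume x: "x \<in> Obj Y"
    show "FArr S (Ide Y x) = Ide (op B) (FObj S x)"
      using faithful[OF S_Arr(1)[OF T.D.Ide_in[OF x]] B.Ide_in] S_Arr(2)[OF T.D.Ide_in[OF x]]
        s[OF x] T_Ide by (simp add: S_Obj)
  next
    fix f g x y z assume f: "f \<in> hom Y x y" and g: "g \<in> hom Y y z"
    show "FArr S (g \<cdot>\<^bsub>Y\<^esub> f) = FArr S g \<cdot>\<^bsub>op B\<^esub> FArr S f"
      using faithful[OF S_Arr(1)[OF T.D.Comp_in[OF f g]] B.Comp_in[OF S_Arr(1)[OF g] S_Arr(1)[OF f]]]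
        T_Comp[OF S_Arr(1)[OF g] S_Arr(1)[OF f]] S_Arr(2)[OF T.D.Comp_in[OF f g]] S_Arr(2)[OF f] S_Arr(2)[OF g]
      by simp
  qed (use s S_Arr B.category_op T.D.category_axioms in \<open>auto simp: S_Obj\<close>)
  have TS_functor: "is_functor Y Y (T \<circ>\<^sub>F S)"
    using is_functor_comp[OF S_functor T] .
  have ST_functor: "is_functor B B (S \<circ>\<^sub>F T)"
    using is_functor_op[OF is_functor_comp[OF T S_functor]] by simp
  have unit: "nat_trans Y Y id_func (T \<circ>\<^sub>F S) (Ide Y)"
    using T.D.is_functor_id TS_functor s S_Arr T.D.Ide_in T.D.Ide_Comp T.D.Comp_Ide
    by (auto simp: nat_trans_def nat_trans_axioms_def S_Obj)
  have counit: "nat_trans B B id_func (S \<circ>\<^sub>F T) \<epsilon>"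
  proof (intro nat_trans.intro nat_trans_axioms.intro)
    fix k b c assume k: "k \<in> hom B b c"
    note Ob = B.hom_Obj[OF k]
    note Tk = T_in[OF k]
    have "FArr T (\<epsilon> c \<cdot>\<^bsub>B\<^esub> k) = FArr T (FArr S (FArr T k) \<cdot>\<^bsub>B\<^esub> \<epsilon> b)"
      using T_Comp[OF k eps(1)] T_Comp[OF eps(1) S_Arr(1)[OF Tk]] S_Arr(2)[OF Tk] eps(2) Ob
        T.D.Comp_Ide[OF Tk] T.D.Ide_Comp[OF Tk] by simp
    then show "\<epsilon> c \<cdot>\<^bsub>B\<^esub> FArr id_func k = FArr (S \<circ>\<^sub>F T) k \<cdot>\<^bsub>B\<^esub> \<epsilon> b"
      using faithful[OF B.Comp_in[OF k eps(1)] B.Comp_in[OF eps(1) S_Arr(1)[OF Tk]]] Ob by simp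
  qed (use B.is_functor_id ST_functor eps in \<open>auto simp: S_Obj\<close>)
  have eps_iso: "is_iso B (\<epsilon> b)" if b: "b \<in> Obj B" for b
  proof -
    note e = eps[OF b]
    have sb: "s (FObj T b) \<in> Obj B" "FObj T (s (FObj T b)) = FObj T b"
      using s T_Obj b by auto
    obtain e' where e': "e' \<in> hom B (s (FObj T b)) b" "FArr T e' = Ide Y (FObj T b)"
      using full[OF sb(1) b] sb(2) T.D.Ide_in[OF T_Obj[OF b]] by auto
    have "Ide Y (FObj T b) \<cdot>\<^bsub>Y\<^esub> Ide Y (FObj T b) = Ide Y (FObj T b)"
      using T.D.Ide_Comp T.D.Ide_in T_Obj b by blast
    then have "e' \<cdot>\<^bsub>B\<^esub> \<epsilon> b = Ide B b" "\<epsilon> b \<cdot>\<^bsub>B\<^esub> e' = Ide B (s (FObj T b))"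
      using faithful[OF B.Comp_in[OF e(1) e'(1)] B.Ide_in[OF b]]
        faithful[OF B.Comp_in[OF e'(1) e(1)] B.Ide_in[OF sb(1)]]
        T_Comp[OF e(1) e'(1)] T_Comp[OF e'(1) e(1)] e(2) e'(2) T_Ide b sb by auto
    then show ?thesis using is_iso_iff_inverse[OF e(1)] e'(1) by blast
  qed
  have eps_S: "\<epsilon> (s y) = Ide B (s y)" if y: "y \<in> Obj Y" for y
    using faithful[OF eps(1), of "s y" "Ide B (s y)"] s[OF y] eps(2)[of "s y"] T_Ide[of "s y"]
      B.Ide_in[of "s y"] by simp
  have "dual_equivalence B Y T S (Ide Y) \<epsilon>"
  proof (intro dual_equivalence.intro dual_adjunction.intro dual_adjunction_axioms.intro
      dual_equivalence_axioms.intro nat_iso.intro nat_iso_axioms.intro)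
    show "trans_eq B (vcomp Y (T \<rhd> \<epsilon>) (Ide Y \<lhd> T)) (id_trans Y T)"
      using eps T.D.Ide_Comp[OF T.D.Ide_in[OF T_Obj]]
      by (auto simp: trans_eq_def vcomp_def whisker_l_def whisker_r_def id_trans_def)
    show "trans_eq Y (vcomp B (S \<rhd> Ide Y) (\<epsilon> \<lhd> S)) (id_trans B S)"
      using is_functor.FArr_Ide[OF S_functor] eps_S s B.Ide_Comp[OF B.Ide_in]
      by (auto simp: trans_eq_def vcomp_def whisker_l_def whisker_r_def id_trans_def S_Obj)
  qed (use T S_functor unit counit eps_iso T.D.is_iso_Ide in auto)
  moreover have "normalized B Y T S (Ide Y) \<epsilon>"
    using s eps eps_S S_Arr(2)[OF Arr_hom]
    by (auto simp: normalized_def func_eq_def trans_eq_def whisker_l_def whisker_r_def id_trans_def S_Obj)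
  ultimately show ?thesis by blast
qed

section \<open>The canonical transformation of a normalized lifting\<close>

text \<open>
  All equations in \<open>B\<close> are tested under the faithful functor \<open>T'\<close>, which sends \<open>\<gamma>\<close> to \<open>\<eta>\<close>.
  Thus naturality of \<open>\<gamma>\<close> comes from that of \<open>\<eta>\<close>, and the last equation from the triangular
  identity \<open>T\<epsilon> \<circ> \<eta>T = 1\<close>.  Invertibility of \<open>\<gamma>\<close> is read off from its two factors.
\<close>

lemma canonical_trans_of_normalized_lifting:
  assumes XY: "full_subcategory X Y"
    and AX: "dual_equivalence A X T S \<eta> \<epsilon>" and BY: "dual_equivalence B Y T' S' \<eta>' \<epsilon>'"
    and I: "is_functor A B I"
    and lifting: "right_lifting A T T' I id_func"
    and normal: "normalized B Y T' S' \<eta>' \<epsilon>'"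
  defines "\<gamma> \<equiv> canonical_trans B S S' I id_func \<eta> \<epsilon>'"
  shows "nat_iso (op X) B (I \<circ>\<^sub>F S) (S' \<circ>\<^sub>F id_func) \<gamma>"
    and "trans_eq X (T' \<rhd> \<gamma>) (id_func \<rhd> \<eta>)"
    and "trans_eq A (vcomp B (\<gamma> \<lhd> T) (I \<rhd> \<epsilon>)) (\<epsilon>' \<lhd> I)"
proof -
  interpret full_subcategory X Y by fact
  interpret AX: dual_equivalence A X T S \<eta> \<epsilon> by fact
  interpret BY: dual_equivalence B Y T' S' \<eta>' \<epsilon>' by fact
  interpret I: is_functor A B I by fact
  have TI_Obj: "FObj T' (FObj I a) = FObj T a" if "a \<in> Obj A" for a
    using lifting that by (simp add: right_lifting_def func_eq_def)
  have TI_Arr: "FArr T' (FArr I \<phi>) = FArr T \<phi>" if "\<phi> \<in> hom A a b" for \<phi> a b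
    using lifting homD[OF that] by (simp add: right_lifting_def func_eq_def)
  have TS_Obj: "FObj T' (FObj S' y) = y" if "y \<in> Obj Y" for y
    using normal that by (simp add: normalized_def func_eq_def)
  have TS_Arr: "FArr T' (FArr S' f) = f" if "f \<in> hom Y y z" for f y z
    using normal homD[OF that] by (simp add: normalized_def func_eq_def)
  have T'eps: "FArr T' (\<epsilon>' b) = Ide Y (FObj T' b)" if "b \<in> Obj B" for b
    using normal that by (simp add: normalized_def trans_eq_def whisker_l_def id_trans_def)
  have T'_Comp: "FArr T' (l \<cdot>\<^bsub>B\<^esub> k) = FArr T' k \<cdot>\<^bsub>Y\<^esub> FArr T' l"
    if "k \<in> hom B b c" "l \<in> hom B c d" for k l b c d
    using BY.T.FArr_Comp[of l d c k b] that by simp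
  have S_Obj: "FObj S x \<in> Obj A" if "x \<in> Obj X" for x
    using AX.S.FObj_in[OF that] by simp
  have I_Obj: "FObj I a \<in> Obj B" if "a \<in> Obj A" for a
    using I.FObj_in[OF that] .
  have eta_Y: "\<eta> x \<in> hom Y x (FObj T (FObj S x))" if "x \<in> Obj X" for x
    using AX.unit_in[OF that] hom_subD by blast
  have eps'_in: "\<epsilon>' (FObj I a) \<in> hom B (FObj I a) (FObj S' (FObj T a))" if "a \<in> Obj A" for a
    using BY.counit_in[OF I_Obj[OF that]] TI_Obj[OF that] by simp
  have S'eta_in: "FArr S' (\<eta> x) \<in> hom B (FObj S' (FObj T (FObj S x))) (FObj S' x)"
    if "x \<in> Obj X" for x
    using BY.S.FArr_in[OF eta_Y[OF that]] by simp
  have gamma: "\<gamma> x = FArr S' (\<eta> x) \<cdot>\<^bsub>B\<^esub> \<epsilon>' (FObj I (FObj S x))" for x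
    by (simp add: \<gamma>_def canonical_trans_def vcomp_def whisker_l_def whisker_r_def)
  have gamma_in: "\<gamma> x \<in> hom B (FObj I (FObj S x)) (FObj S' x)" if "x \<in> Obj X" for x
    unfolding gamma using BY.\<epsilon>.F.C.Comp_in[OF eps'_in[OF S_Obj] S'eta_in] that by blast
  have T'gamma: "FArr T' (\<gamma> x) = \<eta> x" if x: "x \<in> Obj X" for x
    using T'_Comp[OF eps'_in[OF S_Obj[OF x]] S'eta_in[OF x]] TS_Arr[OF eta_Y[OF x]]
      T'eps[OF I_Obj[OF S_Obj[OF x]]] TI_Obj[OF S_Obj[OF x]] Ide_Comp[OF eta_Y[OF x]]
    by (simp add: gamma)
  show "trans_eq X (T' \<rhd> \<gamma>) (id_func \<rhd> \<eta>)"
    by (simp add: trans_eq_def whisker_l_def T'gamma)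
  have gamma_iso: "is_iso B (\<gamma> x)" if x: "x \<in> Obj X" for x
  proof -
    have "is_iso Y (\<eta> x)"
      using is_functor.FArr_iso[OF is_functor_inclusion AX.unit_in[OF x] AX.is_iso_unit[OF x]] by simp
    then have "is_iso B (FArr S' (\<eta> x))"
      using BY.S.FArr_iso[OF eta_Y[OF x]] is_iso_op by metis
    then show ?thesis
      unfolding gamma
      using BY.\<epsilon>.F.C.is_iso_Comp[OF eps'_in[OF S_Obj[OF x]] BY.is_iso_counit[OF I_Obj[OF S_Obj[OF x]]]
          S'eta_in[OF x]] by blast
  qed
  have IS: "is_functor (op X) B (I \<circ>\<^sub>F S)"
    using is_functor_comp[OF _ I, of "op X" S] is_functor_op[OF AX.S.is_functor_axioms] by simp
  have S'J: "is_functor (op X) B (S' \<circ>\<^sub>F id_func)"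
    using is_functor_op[OF is_functor_comp[OF is_functor_inclusion BY.S.is_functor_axioms]] by simp
  show "nat_iso (op X) B (I \<circ>\<^sub>F S) (S' \<circ>\<^sub>F id_func) \<gamma>"
  proof (intro nat_iso.intro nat_trans.intro nat_trans_axioms.intro nat_iso_axioms.intro IS S'J)
    fix f x y assume "f \<in> hom (op X) x y"
    then have f: "f \<in> hom X y x" by simp
    note fY = conjunct1[OF hom_subD[OF f]]
    have Ob: "x \<in> Obj X" "y \<in> Obj X" using hom_subD[OF f] by auto
    have Sf: "FArr S f \<in> hom A (FObj S x) (FObj S y)" using AX.S.FArr_in[OF f] by simp
    have ISf: "FArr I (FArr S f) \<in> hom B (FObj I (FObj S x)) (FObj I (FObj S y))"
      using I.FArr_in[OF Sf] .
    have S'f: "FArr S' f \<in> hom B (FObj S' x) (FObj S' y)" using BY.S.FArr_in[OF fY] by simp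
    have TSf: "FArr T (FArr S f) \<in> hom X (FObj T (FObj S y)) (FObj T (FObj S x))"
      using AX.T.FArr_in[of "FArr S f"] Sf by simp
    have "FArr T' (\<gamma> y \<cdot>\<^bsub>B\<^esub> FArr I (FArr S f)) = FArr T (FArr S f) \<cdot>\<^bsub>Y\<^esub> \<eta> y"
      using T'_Comp[OF ISf gamma_in[OF Ob(2)]] TI_Arr[OF Sf] T'gamma[OF Ob(2)] by simp
    also have "\<dots> = \<eta> x \<cdot>\<^bsub>Y\<^esub> f"
      using AX.\<eta>.naturality[OF f] Comp_sub[OF AX.unit_in[OF Ob(2)] TSf]
        Comp_sub[OF f AX.unit_in[OF Ob(1)]] by simp
    also have "\<dots> = FArr T' (FArr S' f \<cdot>\<^bsub>B\<^esub> \<gamma> x)"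
      using T'_Comp[OF gamma_in[OF Ob(1)] S'f] TS_Arr[OF fY] T'gamma[OF Ob(1)] by simp
    finally have "\<gamma> y \<cdot>\<^bsub>B\<^esub> FArr I (FArr S f) = FArr S' f \<cdot>\<^bsub>B\<^esub> \<gamma> x"
      using BY.T_faithful[OF BY.\<epsilon>.F.C.Comp_in[OF ISf gamma_in[OF Ob(2)]]
          BY.\<epsilon>.F.C.Comp_in[OF gamma_in[OF Ob(1)] S'f]] by blast
    then show "\<gamma> y \<cdot>\<^bsub>B\<^esub> FArr (I \<circ>\<^sub>F S) f = FArr (S' \<circ>\<^sub>F id_func) f \<cdot>\<^bsub>B\<^esub> \<gamma> x" by simp
  qed (use gamma_in gamma_iso in auto)
  show "trans_eq A (vcomp B (\<gamma> \<lhd> T) (I \<rhd> \<epsilon>)) (\<epsilon>' \<lhd> I)"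
    unfolding trans_eq_def vcomp_def whisker_l_def whisker_r_def
  proof
    fix a assume a: "a \<in> Obj A"
    have Ta: "FObj T a \<in> Obj X" using AX.T.FObj_in a by simp
    note ga = gamma_in[OF Ta] and ea = AX.counit_in[OF a]
    note Iea = I.FArr_in[OF ea]
    have Tea: "FArr T (\<epsilon> a) \<in> hom X (FObj T (FObj S (FObj T a))) (FObj T a)"
      using AX.T.FArr_in[of "\<epsilon> a"] ea by simp
    have "FArr T' (\<gamma> (FObj T a) \<cdot>\<^bsub>B\<^esub> FArr I (\<epsilon> a)) = FArr T (\<epsilon> a) \<cdot>\<^bsub>Y\<^esub> \<eta> (FObj T a)"
      using T'_Comp[OF Iea ga] TI_Arr[OF ea] T'gamma[OF Ta] by simp
    also have "\<dots> = Ide Y (FObj T a)"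
      using Comp_sub[OF AX.unit_in[OF Ta] Tea] AX.triangle_T_at[OF a] Ide_eq[OF Ta] by simp
    also have "\<dots> = FArr T' (\<epsilon>' (FObj I a))"
      using T'eps[OF I_Obj[OF a]] TI_Obj[OF a] by simp
    finally show "\<gamma> (FObj T a) \<cdot>\<^bsub>B\<^esub> FArr I (\<epsilon> a) = \<epsilon>' (FObj I a)"
      using BY.T_faithful[OF BY.\<epsilon>.F.C.Comp_in[OF Iea ga] eps'_in[OF a]] by blast
  qed
qed

section \<open>Quotient categories\<close>

locale category_congruence = category C for C :: "('o, 'm) cat" (structure) +
  fixes R :: "'m rel"
  assumes equiv_R: "equiv (Arr C) R"
    and parallel: "(f, f') \<in> R \<Longrightarrow> Dom C f' = Dom C f \<and> Cod C f' = Cod C f"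
    and compatible: "(f, f') \<in> R \<Longrightarrow> (g, g') \<in> R \<Longrightarrow> Dom C g = Cod C f \<Longrightarrow> (g \<cdot> f, g' \<cdot> f') \<in> R"
begin

abbreviation "Q \<equiv> quotient_cat C R"

lemma self_class: "f \<in> Arr C \<Longrightarrow> f \<in> R `` {f}"
  using equiv_R by (rule equiv_class_self)

lemma class_eq_iff: "f \<in> Arr C \<Longrightarrow> g \<in> Arr C \<Longrightarrow> R `` {f} = R `` {g} \<longleftrightarrow> (f, g) \<in> R"
  using eq_equiv_class_iff[OF equiv_R] .

lemma the_elem_image_class:
  assumes "f \<in> Arr C" and "\<And>f'. (f, f') \<in> R \<Longrightarrow> h f' = h f"
  shows "the_elem (h ` (R `` {f})) = h f"
proof -
  have "h ` (R `` {f}) = {h f}" using assms(2) self_class[OF assms(1)] by blast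
  then show ?thesis by simp
qed

lemma hom_quotient: "hom Q x y = (\<lambda>f. R `` {f}) ` hom C x y"
proof -
  have "Dom Q (R `` {f}) = Dom C f" "Cod Q (R `` {f}) = Cod C f" if "f \<in> Arr C" for f
    using the_elem_image_class[of f "Dom C"] the_elem_image_class[of f "Cod C"] parallel that
    by (auto simp: quotient_cat_def)
  moreover have "Arr Q = (\<lambda>f. R `` {f}) ` Arr C"
    by (auto simp: quotient_cat_def quotient_def)
  ultimately show ?thesis by (auto simp: hom_def)
qed

lemma class_in: "f \<in> hom C x y \<Longrightarrow> R `` {f} \<in> hom Q x y"
  by (auto simp: hom_quotient)

text \<open>
  Compatibility makes the union over representatives in the composition of the quotient a union
  of copies of one class; it is a nonempty one because classes contain their representative.
\<close>

lemma Comp_class: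
  assumes f: "f \<in> hom C x y" and g: "g \<in> hom C y z"
  shows "R `` {g} \<cdot>\<^bsub>Q\<^esub> R `` {f} = R `` {g \<cdot> f}"
proof -
  have "R `` {g' \<cdot> f'} = R `` {g \<cdot> f}" if "(f, f') \<in> R" "(g, g') \<in> R" for f' g'
    using equiv_class_eq[OF equiv_R compatible[OF that]] homD[OF f] homD[OF g] by simp
  then have "R `` {g} \<cdot>\<^bsub>Q\<^esub> R `` {f} = (\<Union>g' \<in> R `` {g}. \<Union>f' \<in> R `` {f}. R `` {g \<cdot> f})"
    by (simp add: quotient_cat_def)
  also have "\<dots> = R `` {g \<cdot> f}"
    using self_class[OF homD(1)[OF f]] self_class[OF homD(1)[OF g]] by blast
  finally show ?thesis .
qed

lemma quotient_Obj [simp]: "Obj Q = Obj C"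
  and quotient_Ide [simp]: "Ide Q x = R `` {Ide C x}"
  by (auto simp: quotient_cat_def)

lemma category_quotient: "category Q"
proof -
  have ArrE: "\<exists>f x y. f \<in> hom C x y \<and> K = R `` {f}" if "K \<in> Arr Q" for K
    using Arr_hom[OF that] by (auto simp: hom_quotient)
  show ?thesis
  proof
    fix K assume "K \<in> Arr Q"
    then obtain f x y where f: "f \<in> hom C x y" "K = R `` {f}" using ArrE by blast
    then show "Dom Q K \<in> Obj Q" "Cod Q K \<in> Obj Q"
      using homD[OF class_in[OF f(1)]] hom_Obj by auto
  next
    fix x assume x: "x \<in> Obj Q"
    then show "Ide Q x \<in> hom Q x x" using class_in[OF Ide_in] by simp
  next
    fix K L x y z assume "K \<in> hom Q x y" "L \<in> hom Q y z"
    then obtain f g where "f \<in> hom C x y" "K = R `` {f}" "g \<in> hom C y z" "L = R `` {g}"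
      by (auto simp: hom_quotient)
    then show "L \<cdot>\<^bsub>Q\<^esub> K \<in> hom Q x z" using Comp_class Comp_in class_in by simp
  next
    fix K x y assume "K \<in> hom Q x y"
    then obtain f where f: "f \<in> hom C x y" "K = R `` {f}" by (auto simp: hom_quotient)
    then show "K \<cdot>\<^bsub>Q\<^esub> Ide Q x = K" "Ide Q y \<cdot>\<^bsub>Q\<^esub> K = K"
      using hom_Obj[OF f(1)] Comp_class[OF Ide_in f(1)] Comp_class[OF f(1) Ide_in] Comp_Ide Ide_Comp
      by auto
  next
    fix K L M w x y z assume "K \<in> hom Q w x" "L \<in> hom Q x y" "M \<in> hom Q y z"
    then obtain f g h where "f \<in> hom C w x" "K = R `` {f}" "g \<in> hom C x y" "L = R `` {g}"
      "h \<in> hom C y z" "M = R `` {h}" by (auto simp: hom_quotient)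
    moreover from this have "g \<cdot> f \<in> hom C w y" "h \<cdot> g \<in> hom C x z" using Comp_in by auto
    ultimately show "(M \<cdot>\<^bsub>Q\<^esub> L) \<cdot>\<^bsub>Q\<^esub> K = M \<cdot>\<^bsub>Q\<^esub> (L \<cdot>\<^bsub>Q\<^esub> K)"
      using Comp_assoc by (simp add: Comp_class)
  qed
qed

end

section \<open>The category of covers\<close>

locale cover_setting = A: category A + covering_class X Y P + T: is_functor "op A" X T
  for A :: "('a, 'f) cat" and X Y :: "('y, 'm) cat" and P :: "'m set"
    and T :: "('a, 'f, 'y, 'm) func"
begin

abbreviation "CC \<equiv> cover_cat A Y P T"
abbreviation "RR \<equiv> cover_rel A Y P T"
abbreviation "BB \<equiv> cover_quotient A Y P T"
abbreviation "II \<equiv> cover_embedding A Y P T"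

lemma cover_Obj: "(a, p) \<in> Obj CC \<longleftrightarrow> a \<in> Obj A \<and> p \<in> P \<and> Dom Y p = FObj T a"
  by (auto simp: cover_cat_def)

lemma cover_Arr:
  "((a, p), (\<phi>, f), (a', p')) \<in> Arr CC \<longleftrightarrow> (a, p) \<in> Obj CC \<and> (a', p') \<in> Obj CC \<and>
     \<phi> \<in> hom A a a' \<and> f \<in> hom Y (Cod Y p') (Cod Y p) \<and> p \<cdot>\<^bsub>Y\<^esub> FArr T \<phi> = f \<cdot>\<^bsub>Y\<^esub> p'"
  by (auto simp: cover_cat_def Let_def)

lemma cover_ops [simp]:
  "Dom CC (s, u, t) = s" "Cod CC (s, u, t) = t"
  "Ide CC (a, p) = ((a, p), (Ide A a, Ide Y (Cod Y p)), (a, p))"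
  "(s', (\<phi>', f'), t') \<cdot>\<^bsub>CC\<^esub> (s, (\<phi>, f), t) = (s, (\<phi>' \<cdot>\<^bsub>A\<^esub> \<phi>, f \<cdot>\<^bsub>Y\<^esub> f'), t')"
  by (auto simp: cover_cat_def Let_def)

lemma cover_homE:
  assumes "u \<in> hom CC s t"
  obtains a p \<phi> f a' p' where "s = (a, p)" "t = (a', p')" "u = ((a, p), (\<phi>, f), (a', p'))"
    "(a, p) \<in> Obj CC" "(a', p') \<in> Obj CC" "\<phi> \<in> hom A a a'" "f \<in> hom Y (Cod Y p') (Cod Y p)"
    "p \<cdot>\<^bsub>Y\<^esub> FArr T \<phi> = f \<cdot>\<^bsub>Y\<^esub> p'"
proof -
  obtain a p \<phi> f a' p' where "u = ((a, p), (\<phi>, f), (a', p'))" by (metis prod.exhaust)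
  with assms cover_Arr that show thesis by (auto simp: hom_def)
qed

lemma cover_homI:
  assumes "(a, p) \<in> Obj CC" "(a', p') \<in> Obj CC" "\<phi> \<in> hom A a a'"
    "f \<in> hom Y (Cod Y p') (Cod Y p)" "p \<cdot>\<^bsub>Y\<^esub> FArr T \<phi> = f \<cdot>\<^bsub>Y\<^esub> p'"
  shows "((a, p), (\<phi>, f), (a', p')) \<in> hom CC (a, p) (a', p')"
  using assms cover_Arr by (auto simp: hom_def)

lemma cover_hom: "(a, p) \<in> Obj CC \<Longrightarrow> p \<in> hom Y (FObj T a) (Cod Y p)"
  using P_Arr by (auto simp: cover_Obj hom_def)

lemma T_Obj_Y: "a \<in> Obj A \<Longrightarrow> FObj T a \<in> Obj Y"
  using T.FObj_in[of a] Obj_sub by auto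

lemma T_hom_Y: "\<phi> \<in> hom A a b \<Longrightarrow> FArr T \<phi> \<in> hom Y (FObj T b) (FObj T a)"
  using T.FArr_in[of \<phi> b a] hom_subD by simp

lemma T_Comp_Y:
  assumes "\<phi> \<in> hom A a b" "\<psi> \<in> hom A b c"
  shows "FArr T (\<psi> \<cdot>\<^bsub>A\<^esub> \<phi>) = FArr T \<phi> \<cdot>\<^bsub>Y\<^esub> FArr T \<psi>"
  using T.FArr_Comp[of \<psi> c b \<phi> a] T.FArr_in[of \<phi> b a] T.FArr_in[of \<psi> c b] assms Comp_sub by simp

lemma T_Ide_Y: "a \<in> Obj A \<Longrightarrow> FArr T (Ide A a) = Ide Y (FObj T a)"
  using T.FArr_Ide[of a] Ide_eq T.FObj_in by simp

lemma category_cover: "category CC"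
proof
  fix u assume "u \<in> Arr CC"
  then have "u \<in> hom CC (Dom CC u) (Cod CC u)" by (rule Arr_hom)
  then show "Dom CC u \<in> Obj CC" "Cod CC u \<in> Obj CC" by (auto elim: cover_homE)
next
  fix s assume "s \<in> Obj CC"
  then obtain a p where s: "s = (a, p)" "(a, p) \<in> Obj CC" by (metis prod.exhaust)
  note p = cover_hom[OF s(2)]
  have "p \<cdot>\<^bsub>Y\<^esub> FArr T (Ide A a) = Ide Y (Cod Y p) \<cdot>\<^bsub>Y\<^esub> p"
    using s p Comp_Ide[OF p] Ide_Comp[OF p] T_Ide_Y by (simp add: cover_Obj)
  then show "Ide CC s \<in> hom CC s s"
    unfolding s using cover_homI[OF s(2) s(2)] s A.Ide_in Ide_in hom_Obj[OF p]
    by (simp add: cover_Obj)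
next
  fix u v s t r assume u: "u \<in> hom CC s t" and v: "v \<in> hom CC t r"
  obtain a p \<phi> f a' p' where U: "s = (a, p)" "t = (a', p')" "u = ((a, p), (\<phi>, f), (a', p'))"
    "(a, p) \<in> Obj CC" "(a', p') \<in> Obj CC" "\<phi> \<in> hom A a a'" "f \<in> hom Y (Cod Y p') (Cod Y p)"
    "p \<cdot>\<^bsub>Y\<^esub> FArr T \<phi> = f \<cdot>\<^bsub>Y\<^esub> p'" using u by (rule cover_homE)
  obtain \<psi> g a'' p'' where V: "r = (a'', p'')" "v = ((a', p'), (\<psi>, g), (a'', p''))"
    "(a'', p'') \<in> Obj CC" "\<psi> \<in> hom A a' a''" "g \<in> hom Y (Cod Y p'') (Cod Y p')"
    "p' \<cdot>\<^bsub>Y\<^esub> FArr T \<psi> = g \<cdot>\<^bsub>Y\<^esub> p''" using v U(2) by (auto elim: cover_homE)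
  note p = cover_hom[OF U(4)] cover_hom[OF U(5)] cover_hom[OF V(3)]
  have "p \<cdot>\<^bsub>Y\<^esub> (FArr T \<phi> \<cdot>\<^bsub>Y\<^esub> FArr T \<psi>) = (f \<cdot>\<^bsub>Y\<^esub> p') \<cdot>\<^bsub>Y\<^esub> FArr T \<psi>"
    using Comp_assoc[OF T_hom_Y[OF V(4)] T_hom_Y[OF U(6)] p(1)] U(8) by simp
  also have "\<dots> = f \<cdot>\<^bsub>Y\<^esub> (g \<cdot>\<^bsub>Y\<^esub> p'')"
    using Comp_assoc[OF T_hom_Y[OF V(4)] p(2) U(7)] V(6) by simp
  also have "\<dots> = (f \<cdot>\<^bsub>Y\<^esub> g) \<cdot>\<^bsub>Y\<^esub> p''"
    using Comp_assoc[OF p(3) V(5) U(7)] by simp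
  finally show "v \<cdot>\<^bsub>CC\<^esub> u \<in> hom CC s r"
    using cover_homI[OF U(4) V(3) A.Comp_in[OF U(6) V(4)] Comp_in[OF V(5) U(7)]]
      T_Comp_Y[OF U(6) V(4)] U V by simp
next
  fix u s t assume "u \<in> hom CC s t"
  then show "u \<cdot>\<^bsub>CC\<^esub> Ide CC s = u" "Ide CC t \<cdot>\<^bsub>CC\<^esub> u = u"
    by (auto elim!: cover_homE simp: A.Comp_Ide A.Ide_Comp Comp_Ide Ide_Comp)
next
  fix u v w q s t r assume "u \<in> hom CC q s" "v \<in> hom CC s t" "w \<in> hom CC t r"
  then show "(w \<cdot>\<^bsub>CC\<^esub> v) \<cdot>\<^bsub>CC\<^esub> u = w \<cdot>\<^bsub>CC\<^esub> (v \<cdot>\<^bsub>CC\<^esub> u)"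
    by (auto elim!: cover_homE simp: A.Comp_assoc Comp_assoc)
qed

text \<open>
  The component \<open>f\<close> of an arrow \<open>(\<phi>, f)\<close>, to which the equivalence relation reduces arrows
  between fixed objects.
\<close>

abbreviation base :: "('a, 'f, 'm) cover_arr \<Rightarrow> 'm" where
  "base u \<equiv> snd (fst (snd u))"

lemma cover_rel_iff:
  "(u, v) \<in> RR \<longleftrightarrow> u \<in> Arr CC \<and> v \<in> Arr CC \<and> Dom CC u = Dom CC v \<and> Cod CC u = Cod CC v \<and>
     base u = base v"
  by (cases u; cases v) (auto simp: cover_rel_def)

sublocale cover: category_congruence CC RR
proof (intro category_congruence.intro category_congruence_axioms.intro category_cover)
  interpret C: category CC by (rule category_cover)
  show "equiv (Arr CC) RR"
    by (intro equivI refl_onI symI transI) (auto simp: cover_rel_iff)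
  fix u u' assume u: "(u, u') \<in> RR"
  then show "Dom CC u' = Dom CC u \<and> Cod CC u' = Cod CC u" by (auto simp: cover_rel_iff)
  fix v v' assume v: "(v, v') \<in> RR" and vu: "Dom CC v = Cod CC u"
  have "v \<cdot>\<^bsub>CC\<^esub> u \<in> hom CC (Dom CC u) (Cod CC v)" "v' \<cdot>\<^bsub>CC\<^esub> u' \<in> hom CC (Dom CC u) (Cod CC v)"
    using u v vu by (auto simp: cover_rel_iff hom_def intro!: C.Comp_in[unfolded hom_def, simplified])
  moreover have "base (v \<cdot>\<^bsub>CC\<^esub> u) = base (v' \<cdot>\<^bsub>CC\<^esub> u')"
    using u v by (cases u; cases v; cases u'; cases v') (auto simp: cover_rel_iff)
  ultimately show "(v \<cdot>\<^bsub>CC\<^esub> u, v' \<cdot>\<^bsub>CC\<^esub> u') \<in> RR" by (auto simp: cover_rel_iff hom_def)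
qed

lemma BB_eq: "BB = cover.Q"
  by (simp add: cover_quotient_def)

text \<open>
  Since \<open>base\<close> is constant on each class, it maps a class to a singleton, whose element is
  the value of the functor.
\<close>

definition base_functor ::
  "('a \<times> 'm, ('a, 'f, 'm) cover_arr set, 'y, 'm) func" where
  "base_functor = \<lparr>FObj = (\<lambda>(a, p). Cod Y p), FArr = (\<lambda>K. the_elem (base ` K))\<rparr>"

lemma base_Obj [simp]: "FObj base_functor (a, p) = Cod Y p"
  by (simp add: base_functor_def)

lemma base_class: "u \<in> hom CC s t \<Longrightarrow> FArr base_functor (RR `` {u}) = base u"
  using cover.the_elem_image_class[of u base, OF homD(1)] by (auto simp: base_functor_def cover_rel_iff)

lemma is_functor_base: "is_functor (op BB) Y base_functor"
proof -
  interpret Q: category cover.Q by (rule cover.category_quotient)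
  show ?thesis
    unfolding BB_eq
  proof (intro is_functor.intro is_functor_axioms.intro Q.category_op)
    fix s assume s: "s \<in> Obj (op cover.Q)"
    then show "FObj base_functor s \<in> Obj Y" using hom_Obj[OF cover_hom] by (cases s) auto
    show "FArr base_functor (Ide (op cover.Q) s) = Ide Y (FObj base_functor s)"
      using s base_class[OF cover.Ide_in] by (cases s) auto
  next
    fix K t s assume "K \<in> hom (op cover.Q) t s"
    then obtain u where u: "u \<in> hom CC s t" "K = RR `` {u}" by (auto simp: cover.hom_quotient)
    then show "FArr base_functor K \<in> hom Y (FObj base_functor t) (FObj base_functor s)"
      using base_class[OF u(1)] by (auto elim!: cover_homE)
  next
    fix K L r t s assume "K \<in> hom (op cover.Q) r t" "L \<in> hom (op cover.Q) t s"
    then obtain u v where u: "u \<in> hom CC s t" "L = RR `` {u}" and v: "v \<in> hom CC t r" "K = RR `` {v}"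
      by (auto simp: cover.hom_quotient)
    have "base (v \<cdot>\<^bsub>CC\<^esub> u) = base u \<cdot>\<^bsub>Y\<^esub> base v" by (cases u; cases v) auto
    then show "FArr base_functor (L \<cdot>\<^bsub>op cover.Q\<^esub> K) = FArr base_functor L \<cdot>\<^bsub>Y\<^esub> FArr base_functor K"
      using u v cover.Comp_class[OF u(1) v(1)] base_class[OF u(1)] base_class[OF v(1)]
        base_class[OF cover.Comp_in[OF u(1) v(1)]] by simp
  qed (rule category_axioms)
qed

lemma base_faithful:
  assumes "K \<in> hom BB s t" "L \<in> hom BB s t" and eq: "FArr base_functor K = FArr base_functor L"
  shows "K = L"
proof -
  obtain u v where uv: "u \<in> hom CC s t" "K = RR `` {u}" "v \<in> hom CC s t" "L = RR `` {v}"
    using assms by (auto simp: BB_eq cover.hom_quotient)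
  have "(u, v) \<in> RR"
    using uv eq base_class[OF uv(1)] base_class[OF uv(3)] by (auto simp: cover_rel_iff hom_def)
  then show ?thesis using uv cover.class_eq_iff homD(1) by metis
qed

text \<open>
  The covering property of \<open>p\<close> lifts \<open>f \<circ> p'\<close> to an arrow \<open>TA' \<rightarrow> TA\<close> of \<open>X\<close>, and fullness of
  \<open>T\<close> turns this lift into the first component of a morphism of covers.
\<close>

lemma base_full:
  assumes T_full: "\<And>a b g. a \<in> Obj A \<Longrightarrow> b \<in> Obj A \<Longrightarrow> g \<in> hom X (FObj T b) (FObj T a) \<Longrightarrow>
      \<exists>\<phi> \<in> hom A a b. FArr T \<phi> = g"
    and st: "s \<in> Obj BB" "t \<in> Obj BB"
    and f: "f \<in> hom Y (FObj base_functor t) (FObj base_functor s)"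
  shows "\<exists>K \<in> hom BB s t. FArr base_functor K = f"
proof -
  obtain a p a' p' where [simp]: "s = (a, p)" "t = (a', p')" by (metis prod.exhaust)
  have Ob: "(a, p) \<in> Obj CC" "(a', p') \<in> Obj CC" using st by (auto simp: BB_eq)
  note p = cover_hom[OF Ob(1)] cover_hom[OF Ob(2)]
  have f': "f \<in> hom Y (Cod Y p') (Cod Y p)" using f by simp
  have aa: "a \<in> Obj A" "a' \<in> Obj A" "p \<in> P" "Dom Y p = FObj T a" using Ob by (auto simp: cover_Obj)
  have Taa: "FObj T a \<in> Obj X" "FObj T a' \<in> Obj X" using T.FObj_in aa by auto
  obtain g where g: "g \<in> hom Y (FObj T a') (FObj T a)" "p \<cdot>\<^bsub>Y\<^esub> g = f \<cdot>\<^bsub>Y\<^esub> p'"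
    using P2[OF aa(3) Taa(2) Comp_in[OF p(2) f']] aa(4) by auto
  then obtain \<phi> where \<phi>: "\<phi> \<in> hom A a a'" "FArr T \<phi> = g"
    using T_full[OF aa(1,2)] hom_sub[OF Taa(2,1)] by blast
  have "((a, p), (\<phi>, f), (a', p')) \<in> hom CC (a, p) (a', p')"
    using cover_homI[OF Ob \<phi>(1) f'] \<phi> g by simp
  then show ?thesis
    using base_class cover.class_in by (fastforce simp: BB_eq)
qed

text \<open>
  A cover of \<open>y\<close> need not start at an object of the form \<open>Ta\<close>, but its domain is isomorphic to
  one, and covers are stable under precomposition with isomorphisms.
\<close>

lemma base_surj:
  assumes T_dense: "\<And>x. x \<in> Obj X \<Longrightarrow> \<exists>a \<in> Obj A. \<exists>i \<in> hom X (FObj T a) x. is_iso X i"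
    and y: "y \<in> Obj Y"
  shows "\<exists>s \<in> Obj BB. FObj base_functor s = y"
proof -
  obtain p where p: "p \<in> P" "Dom Y p \<in> Obj X" "Cod Y p = y" using P3[OF y] by blast
  obtain a i where a: "a \<in> Obj A" "i \<in> hom X (FObj T a) (Dom Y p)" "is_iso X i"
    using T_dense[OF p(2)] by blast
  have "p \<in> hom Y (Dom Y p) y" using p P_Arr by (auto simp: hom_def)
  then have "p \<cdot>\<^bsub>Y\<^esub> i \<in> hom Y (FObj T a) y" using Comp_in hom_subD a(2) by blast
  moreover have "p \<cdot>\<^bsub>Y\<^esub> i \<in> P" using P_iso[OF p(1) a(3)] homD[OF a(2)] by simp
  ultimately have "(a, p \<cdot>\<^bsub>Y\<^esub> i) \<in> Obj BB" "FObj base_functor (a, p \<cdot>\<^bsub>Y\<^esub> i) = y"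
    using a(1) by (auto simp: BB_eq cover_Obj hom_def)
  then show ?thesis by blast
qed

lemma embedding_Obj: "FObj II a = (a, Ide Y (FObj T a))"
  by (simp add: cover_embedding_def Let_def)

lemma embedding_Obj_in: "a \<in> Obj A \<Longrightarrow> FObj II a \<in> Obj CC"
  using P1[of "FObj T a"] T.FObj_in[of a] homD(2)[OF Ide_in[OF T_Obj_Y]]
  by (simp add: embedding_Obj cover_Obj)

lemma Cod_Ide_T: "a \<in> Obj A \<Longrightarrow> Cod Y (Ide Y (FObj T a)) = FObj T a"
  using homD(3)[OF Ide_in[OF T_Obj_Y]] .

lemma embedding_Arr:
  assumes "\<phi> \<in> hom A a b"
  shows "FArr II \<phi> = RR `` {(FObj II a, (\<phi>, FArr T \<phi>), FObj II b)}"
    and "(FObj II a, (\<phi>, FArr T \<phi>), FObj II b) \<in> hom CC (FObj II a) (FObj II b)"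
proof -
  have ab: "a \<in> Obj A" "b \<in> Obj A" using A.hom_Obj[OF assms] by auto
  show "FArr II \<phi> = RR `` {(FObj II a, (\<phi>, FArr T \<phi>), FObj II b)}"
    using homD[OF assms] by (simp add: cover_embedding_def Let_def)
  note T\<phi> = T_hom_Y[OF assms]
  show "(FObj II a, (\<phi>, FArr T \<phi>), FObj II b) \<in> hom CC (FObj II a) (FObj II b)"
    using cover_homI[OF embedding_Obj_in[OF ab(1), unfolded embedding_Obj]
        embedding_Obj_in[OF ab(2), unfolded embedding_Obj] assms]
      T\<phi> Cod_Ide_T ab Ide_Comp[OF T\<phi>] Comp_Ide[OF T\<phi>]
    by (simp add: embedding_Obj)
qed

lemma is_functor_embedding: "is_functor A BB II"
  unfolding BB_eq
proof (intro is_functor.intro is_functor_axioms.intro cover.category_quotient A.category_axioms)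
  fix a assume a: "a \<in> Obj A"
  then show "FObj II a \<in> Obj cover.Q" using embedding_Obj_in by simp
  show "FArr II (Ide A a) = Ide cover.Q (FObj II a)"
    using embedding_Arr(1)[OF A.Ide_in[OF a]] T_Ide_Y[OF a] Cod_Ide_T[OF a] by (simp add: embedding_Obj)
next
  fix \<phi> a b assume \<phi>: "\<phi> \<in> hom A a b"
  show "FArr II \<phi> \<in> hom cover.Q (FObj II a) (FObj II b)"
    using cover.class_in[OF embedding_Arr(2)[OF \<phi>]] embedding_Arr(1)[OF \<phi>] by simp
next
  fix \<phi> \<psi> a b c assume \<phi>: "\<phi> \<in> hom A a b" and \<psi>: "\<psi> \<in> hom A b c"
  show "FArr II (\<psi> \<cdot>\<^bsub>A\<^esub> \<phi>) = FArr II \<psi> \<cdot>\<^bsub>cover.Q\<^esub> FArr II \<phi>"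
    using cover.Comp_class[OF embedding_Arr(2)[OF \<phi>] embedding_Arr(2)[OF \<psi>]] T_Comp_Y[OF \<phi> \<psi>]
      embedding_Arr(1)[OF A.Comp_in[OF \<phi> \<psi>]] embedding_Arr(1)[OF \<phi>] embedding_Arr(1)[OF \<psi>] by simp
qed

lemma base_lifts_T: "right_lifting A T base_functor II id_func"
  using embedding_Arr[OF Arr_hom] base_class[OF embedding_Arr(2)[OF Arr_hom]] Cod_Ide_T
  by (auto simp: right_lifting_def func_eq_def embedding_Obj)

end

section \<open>The lifted dual equivalence\<close>

theorem theorem3p6:
  fixes A :: "('a, 'f) cat" and X Y :: "('y, 'm) cat" and P :: "'m set"
    and T :: "('a, 'f, 'y, 'm) func" and S :: "('y, 'm, 'a, 'f) func"
    and \<eta> :: "'y \<Rightarrow> 'm" and \<epsilon> :: "'a \<Rightarrow> 'f"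
    and J :: "('y, 'm, 'y, 'm) func"
    and B :: "('a \<times> 'm, ('a, 'f, 'm) cover_arr set) cat"
    and I :: "('a, 'f, 'a \<times> 'm, ('a, 'f, 'm) cover_arr set) func"
  assumes "category A" and "category Y"
    and "full_subcategory X Y"
    and "covering_class X Y P"
    and "dual_equivalence A X T S \<eta> \<epsilon>"
  defines "J \<equiv> id_func"
    and "B \<equiv> cover_quotient A Y P T"
    and "I \<equiv> cover_embedding A Y P T"
  shows "(\<exists>T' S' \<eta>' \<epsilon>'. dual_equivalence B Y T' S' \<eta>' \<epsilon>' \<and> right_lifting A T T' I J \<and>
            normalized B Y T' S' \<eta>' \<epsilon>') \<and>
         (\<forall>T' S' \<eta>' \<epsilon>'. dual_equivalence B Y T' S' \<eta>' \<epsilon>' \<and> right_lifting A T T' I J \<and>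
            normalized B Y T' S' \<eta>' \<epsilon>' \<longrightarrow>
            (let \<gamma> = canonical_trans B S S' I J \<eta> \<epsilon>' in
               nat_iso (op X) B (I \<circ>\<^sub>F S) (S' \<circ>\<^sub>F J) \<gamma> \<and>
               trans_eq X (T' \<rhd> \<gamma>) (J \<rhd> \<eta>) \<and>
               trans_eq A (vcomp B (\<gamma> \<lhd> T) (I \<rhd> \<epsilon>)) (\<epsilon>' \<lhd> I)))"
proof -
  interpret AX: dual_equivalence A X T S \<eta> \<epsilon> by fact
  interpret cover_setting A X Y P T
    using assms(1,4) AX.T.is_functor_axioms by (rule cover_setting.intro)
  have T_full: "\<exists>\<phi> \<in> hom A a b. FArr T \<phi> = g"
    if "a \<in> Obj A" "b \<in> Obj A" "g \<in> hom X (FObj T b) (FObj T a)" for a b g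
    using AX.T_full[OF that] by blast
  have T_dense: "\<exists>a \<in> Obj A. \<exists>i \<in> hom X (FObj T a) x. is_iso X i" if x: "x \<in> Obj X" for x
  proof -
    obtain i where "i \<in> hom X (FObj T (FObj S x)) x" "i \<cdot>\<^bsub>X\<^esub> \<eta> x = Ide X x"
        "\<eta> x \<cdot>\<^bsub>X\<^esub> i = Ide X (FObj T (FObj S x))"
      using AX.is_iso_unit[OF x] is_iso_iff_inverse[OF AX.unit_in[OF x]] by blast
    then show ?thesis
      using AX.unit_in[OF x] AX.S.FObj_in[OF x] is_iso_iff_inverse by fastforce
  qed
  obtain s where s: "\<And>y. y \<in> Obj Y \<Longrightarrow> s y \<in> Obj B \<and> FObj base_functor (s y) = y"
    using base_surj[OF T_dense] unfolding B_def by metis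
  have "category B" unfolding B_def BB_eq by (rule cover.category_quotient)
  then have "\<exists>S' \<eta>' \<epsilon>'. dual_equivalence B Y base_functor S' \<eta>' \<epsilon>' \<and> normalized B Y base_functor S' \<eta>' \<epsilon>'"
    using normalized_dual_equivalence_of_section[of B Y base_functor s] is_functor_base base_faithful
      base_full[OF T_full] s unfolding B_def by blast
  moreover have "right_lifting A T base_functor I J"
    unfolding I_def J_def by (rule base_lifts_T)
  moreover have "is_functor A B I"
    unfolding B_def I_def by (rule is_functor_embedding)
  ultimately show ?thesis
    using canonical_trans_of_normalized_lifting[OF assms(3,5)] unfolding J_def Let_def by blast
qed

end
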